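(* Consider the stationary Driver-type ODE $\dot x_i=\sum_{j=1}^nv_{i,j}x_ix_j$, $i=1,\dots,n$, with constant real coefficients $v_{i,j}$, and let $x(t)$ be its solution with $x(t_0)=x$, where $x\in\mathcal D$. Set $$\bar r=\frac1{\sigma v_Mx_M}.$$ Then $(t_0-\bar r,t_0+\bar r)\subset\mathbf I(t_0,r)$, and for all $t\in(t_0-\bar r,t_0+\bar r)$ and any $i=1,\dots,n$, $$|x_i(t)|\le\frac{x_M}{1-\sigma v_Mx_M|t-t_0|}.$$
   Context: $\mathcal D=\{x\in\mathbb R^n:x_i\neq0\ \text{for all } i\}$. $\mathcal S=\{j\in\{1,\dots,n\}:\exists i \text{ with } v_{i,j}\ne0\}$ and $\sigma$ is the cardinality of $\mathcal S$. $v_M=\max_{i,j}|v_{i,j}|$ and $x_M=\max_i|x_i|$ (for the initial value $x$). The ODE is considered for $t\in\mathbb R$. $\mathbf I(t_0,r)$ denotes the open interval centered at $t_0$ with radius $r$ on which the Taylor series centered at $t_0$ of the components $x_i(t)$ converge to the solution. If $\sigma v_M=0$, $\bar r=+\infty$ by convention. *)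

theory Defs
  imports "HOL-Analysis.Analysis"
begin

definition nonzero_coords :: "(real ^ 'n) set" where
  "nonzero_coords = {x. \<forall>i. x $ i \<noteq> 0}"

definition driver_solution ::
    "real ^ 'n ^ 'n \<Rightarrow> real \<Rightarrow> real ^ 'n \<Rightarrow> real set \<Rightarrow> (real \<Rightarrow> real ^ 'n) \<Rightarrow> bool" where
  "driver_solution v t0 x0 J x \<longleftrightarrow>
     open J \<and> is_interval J \<and> t0 \<in> J \<and> x t0 = x0 \<and>
     (\<forall>t\<in>J. \<forall>i. ((\<lambda>s. x s $ i) has_real_derivative
        (\<Sum>j\<in>UNIV. v $ i $ j * x t $ i * x t $ j)) (at t))"

text \<open>The solution of the initial value problem is the non-extendable one; \<open>J\<close> is its interval
  of existence, and the values of the total function \<open>x\<close> outside \<open>J\<close> are irrelevant.\<close>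

definition maximal_driver_solution ::
    "real ^ 'n ^ 'n \<Rightarrow> real \<Rightarrow> real ^ 'n \<Rightarrow> real set \<Rightarrow> (real \<Rightarrow> real ^ 'n) \<Rightarrow> bool" where
  "maximal_driver_solution v t0 x0 J x \<longleftrightarrow>
     driver_solution v t0 x0 J x \<and>
     (\<forall>J' y. driver_solution v t0 x0 J' y \<and> J \<subseteq> J' \<and> (\<forall>t\<in>J. y t = x t) \<longrightarrow> J' = J)"

definition active_columns :: "real ^ 'n ^ 'n \<Rightarrow> 'n set" where
  "active_columns v = {j. \<exists>i. v $ i $ j \<noteq> 0}"

definition sigma_card :: "real ^ 'n ^ 'n \<Rightarrow> nat" where
  "sigma_card v = card (active_columns v)"

definition v_max :: "real ^ 'n ^ 'n \<Rightarrow> real" where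
  "v_max v = Max {\<bar>v $ i $ j\<bar> | i j. True}"

definition x_max :: "real ^ 'n \<Rightarrow> real" where
  "x_max x = Max {\<bar>x $ i\<bar> | i. True}"

definition r_bar :: "real ^ 'n ^ 'n \<Rightarrow> real ^ 'n \<Rightarrow> ereal" where
  "r_bar v x =
     (if real (sigma_card v) * v_max v = 0 then \<infinity>
      else ereal (1 / (real (sigma_card v) * v_max v * x_max x)))"

definition centered_ivl :: "real \<Rightarrow> ereal \<Rightarrow> real set" where
  "centered_ivl t0 r = {t. ereal t0 - r < ereal t \<and> ereal t < ereal t0 + r}"

text \<open>The largest radius, possibly infinite, of an open interval centered at \<open>t0\<close> that lies in the
  interval of existence \<open>J\<close> and on which the Taylor series at \<open>t0\<close> of every component
  converges to that component.\<close>

definition taylor_radius :: "real set \<Rightarrow> (real \<Rightarrow> real ^ 'n) \<Rightarrow> real \<Rightarrow> ereal" where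
  "taylor_radius J x t0 =
     Sup {r. 0 \<le> r \<and> (\<forall>t\<in>centered_ivl t0 r. t \<in> J \<and>
        (\<forall>i. (\<lambda>k. (deriv ^^ k) (\<lambda>s. x s $ i) t0 / fact k * (t - t0) ^ k) sums (x t $ i)))}"

definition taylor_ivl :: "real set \<Rightarrow> (real \<Rightarrow> real ^ 'n) \<Rightarrow> real \<Rightarrow> real set" where
  "taylor_ivl J x t0 = centered_ivl t0 (taylor_radius J x t0)"

end

theory Submission
  imports Defs
begin

text \<open>
  The equation is solved by a power series. Inserting
  \<open>x\<^sub>i(t) = (\<Sum>k. a\<^sub>i\<^sub>k (t - t\<^sub>0)^k)\<close> into the equation forces
  \<open>(k + 1) a\<^sub>i\<^sub>,\<^sub>k\<^sub>+\<^sub>1 = (\<Sum>j. v\<^sub>i\<^sub>j (\<Sum>l\<le>k. a\<^sub>i\<^sub>l a\<^sub>j\<^sub>,\<^sub>k\<^sub>-\<^sub>l))\<close>. The inner sum has \<open>k + 1\<close> terms,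
  which cancels the factor \<open>k + 1\<close>, and at most \<open>\<sigma>\<close> indices \<open>j\<close> contribute. With
  \<open>c = \<sigma> v\<^sub>M\<close> this gives \<open>\<bar>a\<^sub>i\<^sub>k\<bar> \<le> x\<^sub>M (c x\<^sub>M)^k\<close> by induction (\<open>abs_driver_coeff_le\<close>): the coefficients
  are dominated by those of \<open>x\<^sub>M / (1 - c x\<^sub>M \<tau>)\<close>, the solution of the scalar majorant equation
  \<open>u' = c u\<^sup>2\<close>, \<open>u(0) = x\<^sub>M\<close>. Hence the series converges for \<open>c x\<^sub>M \<bar>t - t\<^sub>0\<bar> < 1\<close>, obeys the
  asserted bound there and, by termwise differentiation and the Cauchy product, solves the equation
  (\<open>driver_solution_driver_series\<close>). For \<open>c = 0\<close> the condition holds for every \<open>t\<close>, in agreement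
  with the convention for the radius.

  The series must then be compared with the given maximal solution. The right-hand side is locally
  Lipschitz, so solutions are unique on the intersection of their intervals
  (\<open>driver_solution_unique\<close>) and two solutions can be glued. Maximality forces the interval of
  existence to contain the interval of convergence (\<open>maximal_driver_solution_extends\<close>). On that
  interval the solution is the sum of the power series, which is therefore its Taylor series.
\<close>

section \<open>Uniqueness of solutions\<close>

text \<open>A two-sided form of Gronwall's lemma: depending on the side of \<open>t0\<close> on which \<open>t\<close> lies,
  \<open>E s * exp (- L * s)\<close> decreases or \<open>E s * exp (L * s)\<close> increases.\<close>

lemma gronwall_nonpos:
  fixes E E' :: "real \<Rightarrow> real"
  assumes deriv: "\<And>s. s \<in> closed_segment t0 t \<Longrightarrow> (E has_real_derivative E' s) (at s)"
    and bound: "\<And>s. s \<in> closed_segment t0 t \<Longrightarrow> \<bar>E' s\<bar> \<le> L * E s"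
    and init: "E t0 = 0"
  shows "E t \<le> 0"
proof (cases "t0 \<le> t")
  case True
  have "E t * exp (- L * t) \<le> E t0 * exp (- L * t0)"
  proof (rule DERIV_nonpos_imp_nonincreasing[OF True])
    fix s assume "t0 \<le> s" "s \<le> t"
    then have s: "s \<in> closed_segment t0 t"
      using True by (simp add: closed_segment_eq_real_ivl)
    have "((\<lambda>s. E s * exp (- L * s)) has_real_derivative (E' s - L * E s) * exp (- L * s)) (at s)"
      by (auto intro!: derivative_eq_intros deriv[OF s] simp: algebra_simps)
    moreover have "(E' s - L * E s) * exp (- L * s) \<le> 0"
      using bound[OF s] by (intro mult_nonpos_nonneg) auto
    ultimately show "\<exists>y. ((\<lambda>s. E s * exp (- L * s)) has_real_derivative y) (at s) \<and> y \<le> 0"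
      by blast
  qed
  then show ?thesis
    using init by (simp add: mult_le_0_iff)
next
  case False
  then have le: "t \<le> t0" by simp
  have "E t * exp (L * t) \<le> E t0 * exp (L * t0)"
  proof (rule DERIV_nonneg_imp_nondecreasing[OF le])
    fix s assume "t \<le> s" "s \<le> t0"
    then have s: "s \<in> closed_segment t0 t"
      using False by (simp add: closed_segment_eq_real_ivl)
    have "((\<lambda>s. E s * exp (L * s)) has_real_derivative (E' s + L * E s) * exp (L * s)) (at s)"
      by (auto intro!: derivative_eq_intros deriv[OF s] simp: algebra_simps)
    moreover have "0 \<le> (E' s + L * E s) * exp (L * s)"
      using bound[OF s] by (intro mult_nonneg_nonneg) auto
    ultimately show "\<exists>y. ((\<lambda>s. E s * exp (L * s)) has_real_derivative y) (at s) \<and> 0 \<le> y"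
      by blast
  qed
  then show ?thesis
    using init by (simp add: mult_le_0_iff)
qed

text \<open>The Lipschitz estimate for the quadratic field, tested against \<open>x - y\<close>: with \<open>d = x - y\<close>,
  \<open>x\<^sub>i x\<^sub>j - y\<^sub>i y\<^sub>j = d\<^sub>i x\<^sub>j + y\<^sub>i d\<^sub>j\<close>, and each of \<open>\<bar>d\<^sub>i d\<^sub>i\<bar>\<close>, \<open>\<bar>d\<^sub>i d\<^sub>j\<bar>\<close> is at most the sum of
  the squares of the components of \<open>d\<close>.\<close>

lemma driver_field_lipschitz:
  fixes v :: "real ^ 'n ^ 'n" and x y :: "real ^ 'n"
  assumes x: "\<And>i. \<bar>x $ i\<bar> \<le> R" and y: "\<And>i. \<bar>y $ i\<bar> \<le> R"
  shows "\<bar>\<Sum>i\<in>UNIV. 2 * (x $ i - y $ i) *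
             ((\<Sum>j\<in>UNIV. v $ i $ j * x $ i * x $ j) - (\<Sum>j\<in>UNIV. v $ i $ j * y $ i * y $ j))\<bar>
         \<le> (\<Sum>i\<in>UNIV. \<Sum>j\<in>UNIV. 4 * R * \<bar>v $ i $ j\<bar>) * (\<Sum>i\<in>UNIV. (x $ i - y $ i)\<^sup>2)"
proof -
  define d where "d i = x $ i - y $ i" for i
  define E where "E = (\<Sum>i\<in>UNIV. (d i)\<^sup>2)"
  have sq: "(d i)\<^sup>2 \<le> E" for i
    unfolding E_def by (rule member_le_sum) auto
  have dd: "\<bar>d i\<bar> * \<bar>d j\<bar> \<le> E" for i j
  proof -
    have "0 \<le> (\<bar>d i\<bar> - \<bar>d j\<bar>)\<^sup>2" by simp
    then have "2 * (\<bar>d i\<bar> * \<bar>d j\<bar>) \<le> (d i)\<^sup>2 + (d j)\<^sup>2"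
      by (simp add: power2_diff)
    then show ?thesis using sq[of i] sq[of j] by linarith
  qed
  have R: "0 \<le> R" using x[of undefined] by linarith
  have E: "0 \<le> E" unfolding E_def by (simp add: sum_nonneg)
  have term_le: "\<bar>2 * d i * (v $ i $ j * x $ i * x $ j - v $ i $ j * y $ i * y $ j)\<bar>
                 \<le> 4 * R * \<bar>v $ i $ j\<bar> * E" for i j
  proof -
    have split: "2 * d i * (v $ i $ j * x $ i * x $ j - v $ i $ j * y $ i * y $ j)
          = v $ i $ j * (2 * (x $ j * (d i * d i) + y $ i * (d i * d j)))"
      by (simp add: d_def algebra_simps)
    have "\<bar>x $ j * (d i * d i) + y $ i * (d i * d j)\<bar> \<le> R * E + R * E"
    proof (rule order_trans[OF abs_triangle_ineq add_mono])
      show "\<bar>x $ j * (d i * d i)\<bar> \<le> R * E"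
        unfolding abs_mult using x dd[of i i] R by (intro mult_mono) (auto simp del: abs_mult_self_eq)
      show "\<bar>y $ i * (d i * d j)\<bar> \<le> R * E"
        unfolding abs_mult using y dd R by (intro mult_mono) auto
    qed
    then have "\<bar>v $ i $ j\<bar> * (2 * \<bar>x $ j * (d i * d i) + y $ i * (d i * d j)\<bar>)
               \<le> \<bar>v $ i $ j\<bar> * (2 * (R * E + R * E))"
      by (intro mult_left_mono) auto
    then show ?thesis unfolding split abs_mult by (simp add: mult_ac)
  qed
  have "\<bar>\<Sum>i\<in>UNIV. \<Sum>j\<in>UNIV. 2 * d i * (v $ i $ j * x $ i * x $ j - v $ i $ j * y $ i * y $ j)\<bar>
        \<le> (\<Sum>i\<in>UNIV. \<Sum>j\<in>UNIV. 4 * R * \<bar>v $ i $ j\<bar> * E)"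
    by (intro order_trans[OF sum_abs sum_mono] term_le)
  then show ?thesis
    by (simp only: d_def E_def sum_subtractf flip: sum_distrib_left sum_distrib_right)
qed

lemma driver_solution_unique:
  fixes v :: "real ^ 'n ^ 'n" and x y :: "real \<Rightarrow> real ^ 'n"
  assumes x: "driver_solution v t0 x0 J x" and y: "driver_solution v t0 x0 J' y"
    and t: "t \<in> J" "t \<in> J'"
  shows "x t = y t"
proof -
  let ?K = "closed_segment t0 t"
  have K: "?K \<subseteq> J" "?K \<subseteq> J'"
    using x y t unfolding driver_solution_def is_interval_convex_1
    by (blast intro: closed_segment_subset[THEN subsetD])+
  have dx: "((\<lambda>s. x s $ i) has_real_derivative (\<Sum>j\<in>UNIV. v $ i $ j * x s $ i * x s $ j)) (at s)"
    and dy: "((\<lambda>s. y s $ i) has_real_derivative (\<Sum>j\<in>UNIV. v $ i $ j * y s $ i * y s $ j)) (at s)"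
    if "s \<in> ?K" for s i
    using x y K that unfolding driver_solution_def by blast+
  have cont: "continuous_on ?K (\<lambda>s. x s $ i)" "continuous_on ?K (\<lambda>s. y s $ i)" for i
    by (auto intro!: continuous_at_imp_continuous_on DERIV_isCont dx dy)
  have "bounded ((\<lambda>s. \<Sum>i\<in>UNIV. \<bar>x s $ i\<bar> + \<bar>y s $ i\<bar>) ` ?K)"
    by (intro compact_imp_bounded compact_continuous_image continuous_intros cont) simp
  then obtain R where R: "\<And>s. s \<in> ?K \<Longrightarrow> \<bar>\<Sum>i\<in>UNIV. \<bar>x s $ i\<bar> + \<bar>y s $ i\<bar>\<bar> \<le> R"
    unfolding bounded_iff by auto
  have summand: "\<bar>x s $ i\<bar> + \<bar>y s $ i\<bar> \<le> R" if "s \<in> ?K" for s i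
  proof -
    have "\<bar>x s $ i\<bar> + \<bar>y s $ i\<bar> \<le> (\<Sum>i\<in>UNIV. \<bar>x s $ i\<bar> + \<bar>y s $ i\<bar>)"
      by (rule member_le_sum) auto
    then show ?thesis using R[OF that] by linarith
  qed
  have xR: "\<bar>x s $ i\<bar> \<le> R" and yR: "\<bar>y s $ i\<bar> \<le> R" if "s \<in> ?K" for s i
    using summand[OF that, of i] by linarith+
  define E where "E s = (\<Sum>i\<in>UNIV. (x s $ i - y s $ i)\<^sup>2)" for s
  have "E t \<le> 0"
  proof (rule gronwall_nonpos[of t0 t E])
    show "(E has_real_derivative (\<Sum>i\<in>UNIV. 2 * (x s $ i - y s $ i) *
             ((\<Sum>j\<in>UNIV. v $ i $ j * x s $ i * x s $ j)
              - (\<Sum>j\<in>UNIV. v $ i $ j * y s $ i * y s $ j)))) (at s)"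
      if "s \<in> ?K" for s
      unfolding E_def
      by (rule DERIV_sum, rule derivative_eq_intros,
          rule DERIV_diff[OF dx[OF that] dy[OF that]]) simp
    show "\<bar>\<Sum>i\<in>UNIV. 2 * (x s $ i - y s $ i) *
             ((\<Sum>j\<in>UNIV. v $ i $ j * x s $ i * x s $ j)
              - (\<Sum>j\<in>UNIV. v $ i $ j * y s $ i * y s $ j))\<bar>
          \<le> (\<Sum>i\<in>UNIV. \<Sum>j\<in>UNIV. 4 * R * \<bar>v $ i $ j\<bar>) * E s" if "s \<in> ?K" for s
      unfolding E_def by (intro driver_field_lipschitz xR yR that)
    show "E t0 = 0"
      using x y unfolding E_def driver_solution_def by simp
  qed
  then have "E t = 0"
    unfolding E_def by (intro antisym sum_nonneg) auto
  then show ?thesis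
    by (simp add: E_def sum_nonneg_eq_0_iff vec_eq_iff)
qed

text \<open>By uniqueness a solution and a maximal one can be glued along the intersection of their
  intervals, and the glued solution cannot have a larger interval.\<close>

lemma maximal_driver_solution_extends:
  fixes v :: "real ^ 'n ^ 'n" and x y :: "real \<Rightarrow> real ^ 'n"
  assumes x: "maximal_driver_solution v t0 x0 J x" and y: "driver_solution v t0 x0 J' y"
  shows "J' \<subseteq> J"
proof -
  have xs: "driver_solution v t0 x0 J x"
    using x unfolding maximal_driver_solution_def by simp
  define z where "z t = (if t \<in> J then x t else y t)" for t
  have zx: "z t = x t" if "t \<in> J" for t
    using that by (simp add: z_def)
  have zy: "z t = y t" if "t \<in> J'" for t
    using that driver_solution_unique[OF xs y] by (auto simp: z_def)
  have open_J: "open J" "open J'" and t0: "t0 \<in> J" "t0 \<in> J'" "x t0 = x0"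
    using xs y unfolding driver_solution_def by auto
  have "driver_solution v t0 x0 (J \<union> J') z"
    unfolding driver_solution_def
  proof (intro conjI ballI allI)
    show "open (J \<union> J')" using open_J by (rule open_Un)
    show "is_interval (J \<union> J')"
      using xs y t0 unfolding driver_solution_def is_interval_connected_1
      by (intro connected_Un) auto
    show "t0 \<in> J \<union> J'" using t0 by simp
    show "z t0 = x0" using t0 zx by simp
    fix t i assume "t \<in> J \<union> J'"
    then consider "t \<in> J" | "t \<in> J'" by blast
    then show "((\<lambda>s. z s $ i) has_real_derivative (\<Sum>j\<in>UNIV. v $ i $ j * z t $ i * z t $ j)) (at t)"
    proof cases
      case 1
      then have "((\<lambda>s. x s $ i) has_real_derivative
                  (\<Sum>j\<in>UNIV. v $ i $ j * z t $ i * z t $ j)) (at t)"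
        using xs zx unfolding driver_solution_def by simp
      then show ?thesis
        by (rule has_field_derivative_transform_within_open[OF _ open_J(1) 1]) (simp add: zx)
    next
      case 2
      then have "((\<lambda>s. y s $ i) has_real_derivative
                  (\<Sum>j\<in>UNIV. v $ i $ j * z t $ i * z t $ j)) (at t)"
        using y zy unfolding driver_solution_def by simp
      then show ?thesis
        by (rule has_field_derivative_transform_within_open[OF _ open_J(2) 2]) (simp add: zy)
    qed
  qed
  then have "J \<union> J' = J"
    using x zx unfolding maximal_driver_solution_def by blast
  then show ?thesis by blast
qed

section \<open>Taylor coefficients of a convergent power series\<close>

lemma higher_deriv_powser:
  fixes a :: "nat \<Rightarrow> real"
  assumes sm: "\<And>z. \<bar>z\<bar> < K \<Longrightarrow> summable (\<lambda>n. a n * z ^ n)"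
    and f: "\<And>s. \<bar>s - t0\<bar> < K \<Longrightarrow> f s = (\<Sum>n. a n * (s - t0) ^ n)"
    and s: "\<bar>s - t0\<bar> < K"
  shows "(deriv ^^ k) f s = (\<Sum>n. (diffs ^^ k) a n * (s - t0) ^ n)"
proof -
  have summable_diffs: "summable (\<lambda>n. (diffs ^^ k) a n * z ^ n)" if "\<bar>z\<bar> < K" for k z
    using that
    by (induction k arbitrary: z) (auto simp: sm intro!: termdiff_converges[of _ K])
  show ?thesis
    using s
  proof (induction k arbitrary: s)
    case 0
    then show ?case by (simp add: f)
  next
    case (Suc k)
    have "((\<lambda>z. \<Sum>n. (diffs ^^ k) a n * z ^ n) has_real_derivative
           (\<Sum>n. diffs ((diffs ^^ k) a) n * (s - t0) ^ n)) (at (s - t0))"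
      by (rule termdiffs_strong'[where K = K]) (use Suc.prems summable_diffs in auto)
    then have "((\<lambda>s. \<Sum>n. (diffs ^^ k) a n * (s - t0) ^ n) has_real_derivative
           (\<Sum>n. (diffs ^^ Suc k) a n * (s - t0) ^ n)) (at s)"
      using DERIV_shift[of _ _ s "- t0"] by simp
    then have "((deriv ^^ k) f has_real_derivative
           (\<Sum>n. (diffs ^^ Suc k) a n * (s - t0) ^ n)) (at s)"
      by (rule has_field_derivative_transform_within_open[where S = "ball t0 K"])
         (use Suc in \<open>auto simp: dist_real_def abs_minus_commute\<close>)
    then show ?case by (simp add: DERIV_imp_deriv)
  qed
qed

lemma taylor_coeff_powser:
  fixes a :: "nat \<Rightarrow> real"
  assumes "0 < K" and "\<And>z. \<bar>z\<bar> < K \<Longrightarrow> summable (\<lambda>n. a n * z ^ n)"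
    and "\<And>s. \<bar>s - t0\<bar> < K \<Longrightarrow> f s = (\<Sum>n. a n * (s - t0) ^ n)"
  shows "(deriv ^^ k) f t0 / fact k = a k"
proof -
  have diffs: "(diffs ^^ k) a n = fact (n + k) / fact n * a (n + k)" for n
  proof (induction k arbitrary: n)
    case 0
    then show ?case by simp
  next
    case (Suc k)
    have "(diffs ^^ Suc k) a n = real (Suc n) * (diffs ^^ k) a (Suc n)"
      by (simp add: diffs_def)
    also have "\<dots> = fact (n + Suc k) / fact n * a (n + Suc k)"
      unfolding Suc.IH by (simp del: of_nat_Suc)
    finally show ?case .
  qed
  have "(deriv ^^ k) f t0 = (\<Sum>n. (diffs ^^ k) a n * 0 ^ n)"
    using higher_deriv_powser[of K a t0 f t0 k] assms by simp
  also have "\<dots> = fact k * a k"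
    by (simp add: diffs[of 0])
  finally show ?thesis by simp
qed

section \<open>The power series solution\<close>

fun driver_coeff :: "real ^ 'n ^ 'n \<Rightarrow> real ^ 'n \<Rightarrow> nat \<Rightarrow> 'n \<Rightarrow> real" where
  "driver_coeff v x0 0 i = x0 $ i"
| "driver_coeff v x0 (Suc k) i =
     (\<Sum>j\<in>UNIV. v $ i $ j * (\<Sum>l\<le>k. driver_coeff v x0 l i * driver_coeff v x0 (k - l) j))
     / real (Suc k)"

definition driver_series :: "real ^ 'n ^ 'n \<Rightarrow> real ^ 'n \<Rightarrow> real \<Rightarrow> real \<Rightarrow> real ^ 'n" where
  "driver_series v x0 t0 t = (\<chi> i. \<Sum>k. driver_coeff v x0 k i * (t - t0) ^ k)"

text \<open>The reciprocal of the radius of convergence that is guaranteed by the majorant; it vanishes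
  exactly when that radius is infinite.\<close>

definition growth_rate :: "real ^ 'n ^ 'n \<Rightarrow> real ^ 'n \<Rightarrow> real" where
  "growth_rate v x0 = real (sigma_card v) * v_max v * x_max x0"

lemma abs_le_v_max: "\<bar>v $ i $ j\<bar> \<le> v_max v"
proof -
  have "{\<bar>v $ i $ j\<bar> | i j. True} = (\<lambda>(i, j). \<bar>v $ i $ j\<bar>) ` UNIV"
    by auto
  then show ?thesis
    unfolding v_max_def by (intro Max_ge) auto
qed

lemma abs_le_x_max: "\<bar>x $ i\<bar> \<le> x_max x"
  unfolding x_max_def by (intro Max_ge) (auto simp: full_SetCompr_eq)

lemma v_max_nonneg: "0 \<le> v_max v"
  using abs_le_v_max[of v undefined undefined] by linarith

lemma x_max_nonneg: "0 \<le> x_max x"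
  using abs_le_x_max[of x undefined] by linarith

lemma x_max_pos:
  assumes "x \<in> nonzero_coords"
  shows "0 < x_max x"
  using assms abs_le_x_max[of x undefined] unfolding nonzero_coords_def
  by (simp add: less_le_trans[of 0 "\<bar>x $ undefined\<bar>"])

lemma growth_rate_nonneg: "0 \<le> growth_rate v x0"
  by (simp add: growth_rate_def v_max_nonneg x_max_nonneg)

text \<open>Only active columns enter a row sum, which is why \<open>\<sigma>\<close> and not the dimension appears.\<close>

lemma sum_abs_row_le: "(\<Sum>j\<in>UNIV. \<bar>v $ i $ j\<bar>) \<le> real (sigma_card v) * v_max v"
proof -
  have "(\<Sum>j\<in>UNIV. \<bar>v $ i $ j\<bar>) = (\<Sum>j\<in>active_columns v. \<bar>v $ i $ j\<bar>)"
    by (rule sum.mono_neutral_right) (auto simp: active_columns_def)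
  also have "\<dots> \<le> real (sigma_card v) * v_max v"
    unfolding sigma_card_def by (intro sum_bounded_above abs_le_v_max)
  finally show ?thesis .
qed

text \<open>The majorant estimate. Each of the \<open>k + 1\<close> products in the convolution is at most
  \<open>x\<^sub>M\<^sup>2 (c x\<^sub>M)^k\<close>, a bound without \<open>l\<close>, so the division by \<open>k + 1\<close> removes their number.\<close>

lemma abs_driver_coeff_le:
  "\<bar>driver_coeff v x0 k i\<bar> \<le> x_max x0 * growth_rate v x0 ^ k"
proof (induction k arbitrary: i rule: less_induct)
  case (less k)
  define M where "M = x_max x0"
  define q where "q = growth_rate v x0"
  have nonneg: "0 \<le> M" "0 \<le> q"
    by (simp_all add: M_def q_def x_max_nonneg growth_rate_nonneg)
  show ?case
  proof (cases k)
    case 0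
    then show ?thesis by (simp add: abs_le_x_max)
  next
    case (Suc m)
    have IH: "\<bar>driver_coeff v x0 l i\<bar> \<le> M * q ^ l" if "l \<le> m" for l i
      using less.IH[of l i] that Suc by (simp add: M_def q_def)
    have conv: "\<bar>\<Sum>l\<le>m. driver_coeff v x0 l i * driver_coeff v x0 (m - l) j\<bar>
                \<le> real (Suc m) * (M\<^sup>2 * q ^ m)" for j
    proof -
      have "\<bar>driver_coeff v x0 l i * driver_coeff v x0 (m - l) j\<bar> \<le> M\<^sup>2 * q ^ m" if "l \<le> m" for l
      proof -
        have "\<bar>driver_coeff v x0 l i\<bar> * \<bar>driver_coeff v x0 (m - l) j\<bar>
              \<le> (M * q ^ l) * (M * q ^ (m - l))"
          using nonneg by (intro mult_mono IH that) auto
        also have "\<dots> = M\<^sup>2 * q ^ m"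
          using that by (simp add: power2_eq_square mult_ac flip: power_add)
        finally show ?thesis by (simp add: abs_mult)
      qed
      then have "(\<Sum>l\<le>m. \<bar>driver_coeff v x0 l i * driver_coeff v x0 (m - l) j\<bar>)
                 \<le> real (card {..m}) * (M\<^sup>2 * q ^ m)"
        by (intro sum_bounded_above) auto
      then show ?thesis
        using order_trans[OF sum_abs] by simp
    qed
    have "\<bar>\<Sum>j\<in>UNIV. v $ i $ j * (\<Sum>l\<le>m. driver_coeff v x0 l i * driver_coeff v x0 (m - l) j)\<bar>
          \<le> (\<Sum>j\<in>UNIV. \<bar>v $ i $ j\<bar> * (real (Suc m) * (M\<^sup>2 * q ^ m)))"
      using conv by (intro order_trans[OF sum_abs sum_mono]) (auto simp: abs_mult intro!: mult_left_mono)
    also have "\<dots> = (\<Sum>j\<in>UNIV. \<bar>v $ i $ j\<bar>) * (real (Suc m) * (M\<^sup>2 * q ^ m))"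
      by (simp add: sum_distrib_right)
    also have "\<dots> \<le> (real (sigma_card v) * v_max v) * (real (Suc m) * (M\<^sup>2 * q ^ m))"
      using nonneg by (intro mult_right_mono sum_abs_row_le) auto
    also have "\<dots> = real (Suc m) * (M * q ^ Suc m)"
      by (simp add: q_def M_def growth_rate_def power2_eq_square)
    finally show ?thesis
      unfolding Suc M_def[symmetric] q_def[symmetric] driver_coeff.simps
      by (simp add: pos_divide_le_eq mult_ac del: of_nat_Suc power_Suc)
  qed
qed

lemma norm_driver_series_term_le:
  "norm (driver_coeff v x0 k i * z ^ k) \<le> x_max x0 * (growth_rate v x0 * \<bar>z\<bar>) ^ k"
  using mult_right_mono[OF abs_driver_coeff_le, of "\<bar>z\<bar> ^ k"]
  by (simp add: abs_mult power_abs power_mult_distrib mult_ac)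

context
  fixes v :: "real ^ 'n ^ 'n" and x0 :: "real ^ 'n" and z :: real
  assumes z: "growth_rate v x0 * \<bar>z\<bar> < 1"
begin

lemma sums_majorant:
  "(\<lambda>k. x_max x0 * (growth_rate v x0 * \<bar>z\<bar>) ^ k) sums (x_max x0 / (1 - growth_rate v x0 * \<bar>z\<bar>))"
  using sums_mult[OF geometric_sums[of "growth_rate v x0 * \<bar>z\<bar>"], of "x_max x0"]
    z growth_rate_nonneg[of v x0]
  by (simp add: abs_mult)

lemma summable_norm_driver_series: "summable (\<lambda>k. norm (driver_coeff v x0 k i * z ^ k))"
  by (rule summable_comparison_test'[OF sums_summable[OF sums_majorant], of 0])
     (use norm_driver_series_term_le in simp)

lemma summable_driver_series: "summable (\<lambda>k. driver_coeff v x0 k i * z ^ k)"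
  using summable_norm_driver_series by (rule summable_norm_cancel)

lemma abs_driver_series_le:
  "\<bar>\<Sum>k. driver_coeff v x0 k i * z ^ k\<bar> \<le> x_max x0 / (1 - growth_rate v x0 * \<bar>z\<bar>)"
proof -
  have "\<bar>\<Sum>k. driver_coeff v x0 k i * z ^ k\<bar> \<le> (\<Sum>k. norm (driver_coeff v x0 k i * z ^ k))"
    using summable_norm[OF summable_norm_driver_series] by simp
  also have "\<dots> \<le> (\<Sum>k. x_max x0 * (growth_rate v x0 * \<bar>z\<bar>) ^ k)"
    by (intro suminf_le norm_driver_series_term_le summable_norm_driver_series
        sums_summable[OF sums_majorant])
  also have "\<dots> = x_max x0 / (1 - growth_rate v x0 * \<bar>z\<bar>)"
    by (rule sums_unique[OF sums_majorant, symmetric])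
  finally show ?thesis .
qed

text \<open>The recursion for the coefficients says that the termwise derivative is the combination of
  Cauchy products prescribed by the equation.\<close>

lemma suminf_diffs_driver_coeff:
  "(\<Sum>k. diffs (\<lambda>k. driver_coeff v x0 k i) k * z ^ k)
   = (\<Sum>j\<in>UNIV. v $ i $ j * (\<Sum>k. driver_coeff v x0 k i * z ^ k) * (\<Sum>k. driver_coeff v x0 k j * z ^ k))"
proof -
  let ?b = "\<lambda>i k. driver_coeff v x0 k i * z ^ k"
  let ?conv = "\<lambda>j k. \<Sum>l\<le>k. ?b i l * ?b j (k - l)"
  have conv_power: "?conv j k
      = (\<Sum>l\<le>k. driver_coeff v x0 l i * driver_coeff v x0 (k - l) j) * z ^ k" for j k
    unfolding sum_distrib_right
    by (rule sum.cong) (auto simp: mult_ac simp flip: power_add)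
  have coeff: "diffs (\<lambda>k. driver_coeff v x0 k i) k * z ^ k = (\<Sum>j\<in>UNIV. v $ i $ j * ?conv j k)" for k
    unfolding conv_power
    by (simp add: diffs_def sum_distrib_right mult.assoc del: of_nat_Suc)
  have cauchy: "?conv j sums ((\<Sum>k. ?b i k) * (\<Sum>k. ?b j k))" for j
    by (rule Cauchy_product_sums) (rule summable_norm_driver_series)+
  have "(\<lambda>k. \<Sum>j\<in>UNIV. v $ i $ j * ?conv j k)
        sums (\<Sum>j\<in>UNIV. v $ i $ j * ((\<Sum>k. ?b i k) * (\<Sum>k. ?b j k)))"
    by (intro sums_sum sums_mult cauchy)
  then show ?thesis
    unfolding coeff by (simp add: sums_iff mult_ac)
qed

end

lemma driver_solution_driver_series:
  fixes v :: "real ^ 'n ^ 'n"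
  shows "driver_solution v t0 x0 {t. growth_rate v x0 * \<bar>t - t0\<bar> < 1} (driver_series v x0 t0)"
    (is "driver_solution v t0 x0 ?B _")
  unfolding driver_solution_def
proof (intro conjI ballI allI)
  let ?q = "growth_rate v x0"
  show "open ?B"
    by (intro open_Collect_less continuous_intros)
  show "is_interval ?B"
  proof (unfold is_interval_1, intro ballI allI impI)
    fix a b s assume "a \<in> ?B" "b \<in> ?B" and s: "a \<le> s \<and> s \<le> b"
    moreover from s have "\<bar>s - t0\<bar> \<le> max \<bar>a - t0\<bar> \<bar>b - t0\<bar>"
      by linarith
    then have "?q * \<bar>s - t0\<bar> \<le> ?q * max \<bar>a - t0\<bar> \<bar>b - t0\<bar>"
      by (rule mult_left_mono) (rule growth_rate_nonneg)
    ultimately show "s \<in> ?B"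
      by (auto simp: max_def split: if_splits)
  qed
  show "t0 \<in> ?B" by simp
  show "driver_series v x0 t0 t0 = x0"
    by (simp add: driver_series_def vec_eq_iff)
  fix t i assume t: "t \<in> ?B"
  (* A slightly larger radius, at which the series still converges. *)
  obtain K where K: "\<bar>t - t0\<bar> < K" "?q * K < 1"
  proof (cases "?q = 0")
    case True
    then show ?thesis using that[of "\<bar>t - t0\<bar> + 1"] by simp
  next
    case False
    then have "0 < ?q" using growth_rate_nonneg[of v x0] by simp
    then have "\<bar>t - t0\<bar> < 1 / ?q" using t by (simp add: field_simps)
    then obtain K where "\<bar>t - t0\<bar> < K" "K < 1 / ?q" using dense by blast
    then show ?thesis using that[of K] \<open>0 < ?q\<close> by (simp add: field_simps)
  qed
  have "summable (\<lambda>k. driver_coeff v x0 k i * K ^ k)"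
    using K by (intro summable_driver_series) simp
  then have "((\<lambda>z. \<Sum>k. driver_coeff v x0 k i * z ^ k) has_real_derivative
        (\<Sum>k. diffs (\<lambda>k. driver_coeff v x0 k i) k * (t - t0) ^ k)) (at (t - t0))"
    by (rule termdiffs_strong) (use K in simp)
  then have "((\<lambda>s. \<Sum>k. driver_coeff v x0 k i * (s - t0) ^ k) has_real_derivative
        (\<Sum>k. diffs (\<lambda>k. driver_coeff v x0 k i) k * (t - t0) ^ k)) (at t)"
    using DERIV_shift[of _ _ t "- t0"] by simp
  then show "((\<lambda>s. driver_series v x0 t0 s $ i) has_real_derivative
      (\<Sum>j\<in>UNIV. v $ i $ j * driver_series v x0 t0 t $ i * driver_series v x0 t0 t $ j)) (at t)"
    using t by (simp add: driver_series_def suminf_diffs_driver_coeff)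
qed

section \<open>Comparison with the maximal solution\<close>

lemma centered_ivl_r_bar:
  assumes "x0 \<in> nonzero_coords"
  shows "centered_ivl t0 (r_bar v x0) = {t. growth_rate v x0 * \<bar>t - t0\<bar> < 1}"
proof (cases "real (sigma_card v) * v_max v = 0")
  case True
  then show ?thesis by (auto simp: centered_ivl_def r_bar_def growth_rate_def)
next
  case False
  have pos: "0 < growth_rate v x0"
    using False growth_rate_nonneg[of v x0] x_max_pos[OF assms]
    by (simp add: growth_rate_def order_le_less)
  have "r_bar v x0 = ereal (1 / growth_rate v x0)"
    unfolding r_bar_def growth_rate_def using False by (rule if_not_P)
  then have "centered_ivl t0 (r_bar v x0) = {t. \<bar>t - t0\<bar> < 1 / growth_rate v x0}"
    by (auto simp: centered_ivl_def)
  also have "\<dots> = {t. growth_rate v x0 * \<bar>t - t0\<bar> < 1}"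
    using pos by (simp add: pos_less_divide_eq mult.commute)
  finally show ?thesis .
qed

lemma centered_ivl_mono: "r \<le> r' \<Longrightarrow> centered_ivl t0 r \<subseteq> centered_ivl t0 r'"
  unfolding centered_ivl_def
  by (auto intro: le_less_trans[OF ereal_minus_mono[OF order_refl]]
      less_le_trans[OF _ add_left_mono])

lemma r_bar_nonneg: "0 \<le> r_bar v x0"
  by (simp add: r_bar_def v_max_nonneg x_max_nonneg)

theorem theorem3p6:
  fixes v :: "real ^ 'n ^ 'n" and x0 :: "real ^ 'n" and t0 :: real
    and x :: "real \<Rightarrow> real ^ 'n" and J :: "real set"
  assumes "x0 \<in> nonzero_coords"
    and "maximal_driver_solution v t0 x0 J x"
  shows "centered_ivl t0 (r_bar v x0) \<subseteq> taylor_ivl J x t0 \<and>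
    (\<forall>t\<in>centered_ivl t0 (r_bar v x0). \<forall>i.
       \<bar>x t $ i\<bar> \<le> x_max x0 / (1 - real (sigma_card v) * v_max v * x_max x0 * \<bar>t - t0\<bar>))"
proof -
  let ?q = "growth_rate v x0"
  let ?B = "{t. ?q * \<bar>t - t0\<bar> < 1}"
  note B = centered_ivl_r_bar[OF assms(1), of t0 v]
  note series = driver_solution_driver_series[of v t0 x0]
  have sub: "?B \<subseteq> J"
    by (rule maximal_driver_solution_extends[OF assms(2) series])
  have x_eq: "x t $ i = (\<Sum>k. driver_coeff v x0 k i * (t - t0) ^ k)" if "t \<in> ?B" for t i
  proof -
    have "x t = driver_series v x0 t0 t"
      using driver_solution_unique[OF _ series] assms(2) that sub
      unfolding maximal_driver_solution_def by blast
    then show ?thesis by (simp add: driver_series_def)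
  qed
  have taylor: "(deriv ^^ k) (\<lambda>s. x s $ i) t0 / fact k = driver_coeff v x0 k i" for k i
  proof (rule taylor_coeff_powser)
    (* The 1 in the denominator keeps this radius positive and finite when the rate vanishes. *)
    show "0 < 1 / (?q + 1)" using growth_rate_nonneg[of v x0] by simp
    have small: "?q * \<bar>z\<bar> < 1" if "\<bar>z\<bar> < 1 / (?q + 1)" for z
    proof -
      have "?q * \<bar>z\<bar> \<le> (?q + 1) * \<bar>z\<bar>" by (simp add: mult_right_mono)
      also have "\<dots> < 1" using that growth_rate_nonneg[of v x0] by (simp add: field_simps)
      finally show ?thesis .
    qed
    show "summable (\<lambda>n. driver_coeff v x0 n i * z ^ n)" if "\<bar>z\<bar> < 1 / (?q + 1)" for z
      by (intro summable_driver_series small that)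
    show "x s $ i = (\<Sum>n. driver_coeff v x0 n i * (s - t0) ^ n)" if "\<bar>s - t0\<bar> < 1 / (?q + 1)" for s
      using small[OF that] by (simp add: x_eq)
  qed
  have "(\<lambda>k. (deriv ^^ k) (\<lambda>s. x s $ i) t0 / fact k * (t - t0) ^ k) sums (x t $ i)"
    if "t \<in> ?B" for t i
    unfolding taylor x_eq[OF that] using that by (intro summable_sums summable_driver_series) simp
  then have "r_bar v x0 \<le> taylor_radius J x t0"
    unfolding taylor_radius_def using sub B by (intro Sup_upper) (auto simp: r_bar_nonneg)
  then have "centered_ivl t0 (r_bar v x0) \<subseteq> taylor_ivl J x t0"
    unfolding taylor_ivl_def by (rule centered_ivl_mono)
  moreover have "\<bar>x t $ i\<bar> \<le> x_max x0 / (1 - ?q * \<bar>t - t0\<bar>)" if "t \<in> ?B" for t i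
    unfolding x_eq[OF that] using that by (intro abs_driver_series_le) simp
  ultimately show ?thesis
    unfolding B growth_rate_def by blast
qed

end
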